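(* Let $0\le\rho<\infty$ and let $\tilde g\in RT_\rho$. Suppose that for every $l\ge 1$ the radius of convergence of the power series $\frac{1}{\tilde g^{(l)}}$ is greater than $\rho$. Then the random structure converges if $\big(\tilde g^{(l)}(\rho)\big)^{-1}>0$ for all $l\ge 1$, and it diverges if $\big(\tilde g^{(l)}(\rho)\big)^{-1}=0$ for all $l\ge 1$. Here $\big(\tilde g^{(l)}(\rho)\big)^{-1}$ denotes the value at $\rho$ of the power series $\frac1{\tilde g^{(l)}}$.
   Context: Let $\{Z_j,\ j\ge 1\}$ be independent random variables with values in the nonnegative integers, $a^{(j)}_k=\mathbb{P}(Z_j=k)$, $c_n=\mathbb{P}(\sum_{j=1}^n jZ_j=n)$. Standing assumptions: $c_n>0$ for all $n\ge 1$ and $a^{(j)}_0>0$ for all $j\ge 1$. The associated random structure has counting process $\{\mathbf{K}^{(n)}=(K^{(n)}_1,\dots,K^{(n)}_n),\ n\ge 1\}$ defined by $\mathcal{L}(\mathbf{K}^{(n)})=\mathcal{L}\big(Z_1,\dots,Z_n\,\big|\,\sum_{j=1}^n jZ_j=n\big)$. The random structure is said to converge if for each fixed $l\ge 1$ the law of $(K^{(n)}_1,\dots,K^{(n)}_l)$ converges weakly, as $n\to\infty$, to some probability law on $\mathbb{R}^l$; otherwise it diverges. Put $\tilde a^{(j)}_k=a^{(j)}_k/a^{(j)}_0$ and define the formal power series $\tilde S^{(j)}(x)=\sum_{k\ge 0}\tilde a^{(j)}_k x^{kj}$, $\tilde g=\prod_{j\ge 1}\tilde S^{(j)}$, and $\tilde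 g^{(l)}=\prod_{j=1}^{l}\tilde S^{(j)}$ for $l\ge 1$. Then $\tilde g(x)=\sum_{n\ge 0}\tilde c_n x^n$ with $\tilde c_0=1$, $\tilde c_n=\big(\prod_{j=1}^n a^{(j)}_0\big)^{-1}c_n$. The series $\frac{1}{\tilde g^{(l)}}$ is the multiplicative inverse of $\tilde g^{(l)}$ as a formal power series (its constant term is $1$). For $0\le\rho\le\infty$, $RT_\rho$ is the collection of sequences $\{d_n\}$ of nonnegative numbers with $\lim_{n\to\infty}d_n/d_{n+1}=\rho$; a power series $\sum_n d_nx^n$ is said to be in $RT_\rho$ if $\{d_n\}\in RT_\rho$. *)

theory Defs
  imports "HOL-Probability.Probability"
begin

unbundle no vec_syntax
unbundle fps_syntax

definition a_prob :: "'a measure \<Rightarrow> (nat \<Rightarrow> 'a \<Rightarrow> nat) \<Rightarrow> nat \<Rightarrow> nat \<Rightarrow> real" where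
  "a_prob M Z j k = \<P>(\<omega> in M. Z j \<omega> = k)"

definition size_event :: "'a measure \<Rightarrow> (nat \<Rightarrow> 'a \<Rightarrow> nat) \<Rightarrow> nat \<Rightarrow> 'a set" where
  "size_event M Z n = {\<omega> \<in> space M. (\<Sum>j=1..n. j * Z j \<omega>) = n}"

definition c_prob :: "'a measure \<Rightarrow> (nat \<Rightarrow> 'a \<Rightarrow> nat) \<Rightarrow> nat \<Rightarrow> real" where
  "c_prob M Z n = measure M (size_event M Z n)"

text \<open>The law of \<open>(K\<^sub>1, \<dots>, K\<^sub>n)\<close>, i.e. the conditional law of \<open>(Z\<^sub>1, \<dots>, Z\<^sub>n)\<close> given that
  \<open>1 * Z\<^sub>1 + \<dots> + n * Z\<^sub>n = n\<close>. Vectors are extensional functions on the index set.\<close>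

definition counting_law :: "'a measure \<Rightarrow> (nat \<Rightarrow> 'a \<Rightarrow> nat) \<Rightarrow> nat \<Rightarrow> (nat \<Rightarrow> nat) measure" where
  "counting_law M Z n =
     distr (uniform_measure M (size_event M Z n)) (\<Pi>\<^sub>M j\<in>{1..n}. count_space UNIV)
       (\<lambda>\<omega>. \<lambda>j\<in>{1..n}. Z j \<omega>)"

text \<open>The law of \<open>(K\<^sub>1, \<dots>, K\<^sub>l)\<close> on \<open>\<real>\<^sup>l\<close>. It is meaningful only for \<open>l \<le> n\<close>; it is used below
  only in limits as \<open>n \<rightarrow> \<infinity>\<close> with \<open>l\<close> fixed.\<close>

definition initial_law :: "'a measure \<Rightarrow> (nat \<Rightarrow> 'a \<Rightarrow> nat) \<Rightarrow> nat \<Rightarrow> nat \<Rightarrow> (nat \<Rightarrow> real) measure" where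
  "initial_law M Z l n =
     distr (counting_law M Z n) (\<Pi>\<^sub>M j\<in>{1..l}. borel) (\<lambda>k. \<lambda>j\<in>{1..l}. real (k j))"

text \<open>Weak convergence of laws on \<open>\<real>\<^sup>l\<close>, tested on bounded continuous functions. The library's
  \<^const>\<open>weak_conv_m\<close> covers the real line only.\<close>

definition weak_conv_on_Rn ::
    "nat \<Rightarrow> (nat \<Rightarrow> (nat \<Rightarrow> real) measure) \<Rightarrow> (nat \<Rightarrow> real) measure \<Rightarrow> bool" where
  "weak_conv_on_Rn l \<nu> \<mu> \<longleftrightarrow>
     (\<forall>f. continuous_map (powertop_real {1..l}) euclideanreal f
          \<and> bounded (f ` topspace (powertop_real {1..l}))
        \<longrightarrow> (\<lambda>n. integral\<^sup>L (\<nu> n) f) \<longlonglongrightarrow> integral\<^sup>L \<mu> f)"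

definition structure_converges :: "'a measure \<Rightarrow> (nat \<Rightarrow> 'a \<Rightarrow> nat) \<Rightarrow> bool" where
  "structure_converges M Z \<longleftrightarrow>
     (\<forall>l\<ge>1. \<exists>\<mu>. prob_space \<mu> \<and> sets \<mu> = sets (\<Pi>\<^sub>M j\<in>{1..l}. (borel :: real measure))
                \<and> weak_conv_on_Rn l (initial_law M Z l) \<mu>)"

abbreviation structure_diverges :: "'a measure \<Rightarrow> (nat \<Rightarrow> 'a \<Rightarrow> nat) \<Rightarrow> bool" where
  "structure_diverges M Z \<equiv> \<not> structure_converges M Z"

definition a_tilde :: "'a measure \<Rightarrow> (nat \<Rightarrow> 'a \<Rightarrow> nat) \<Rightarrow> nat \<Rightarrow> nat \<Rightarrow> real" where
  "a_tilde M Z j k = a_prob M Z j k / a_prob M Z j 0"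

text \<open>\<open>S_tilde M Z j\<close> is used only for \<open>j \<ge> 1\<close>, where substituting \<open>x\<^sup>j\<close> is legitimate.\<close>

definition S_tilde :: "'a measure \<Rightarrow> (nat \<Rightarrow> 'a \<Rightarrow> nat) \<Rightarrow> nat \<Rightarrow> real fps" where
  "S_tilde M Z j = Abs_fps (a_tilde M Z j) oo fps_X ^ j"

definition g_tilde_trunc :: "'a measure \<Rightarrow> (nat \<Rightarrow> 'a \<Rightarrow> nat) \<Rightarrow> nat \<Rightarrow> real fps" where
  "g_tilde_trunc M Z l = (\<Prod>j=1..l. S_tilde M Z j)"

text \<open>The infinite product is taken in the \<open>x\<close>-adic topology of \<^typ>\<open>real fps\<close>; it converges,
  see \<open>g_tilde_has_prod\<close> below.\<close>

definition g_tilde :: "'a measure \<Rightarrow> (nat \<Rightarrow> 'a \<Rightarrow> nat) \<Rightarrow> real fps" where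
  "g_tilde M Z = (\<Prod>j. S_tilde M Z (Suc j))"

text \<open>The second conjunct is implicit in forming the quotients: it excludes the convention
  \<open>x / 0 = 0\<close> from producing a limit.\<close>

definition RT :: "ereal \<Rightarrow> (nat \<Rightarrow> real) set" where
  "RT \<rho> = {d. (\<forall>n. d n \<ge> 0) \<and> (\<forall>\<^sub>F n in sequentially. d n \<noteq> 0)
              \<and> (\<lambda>n. ereal (d n / d (Suc n))) \<longlonglongrightarrow> \<rho>}"

lemma S_tilde_nth:
  assumes "j \<ge> 1"
  shows "S_tilde M Z j $ m = (if j dvd m then a_tilde M Z j (m div j) else 0)"
proof -
  have "S_tilde M Z j $ m = (\<Sum>i=0..m. if m = j * i then a_tilde M Z j i else 0)"
    unfolding S_tilde_def fps_compose_nth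
    by (intro sum.cong) (auto simp: fps_X_power_nth simp flip: power_mult)
  also have "\<dots> = (if j dvd m then a_tilde M Z j (m div j) else 0)"
  proof (cases "j dvd m")
    case True
    then obtain q where q: "m = j * q" by blast
    have "(\<Sum>i=0..m. if m = j * i then a_tilde M Z j i else 0)
        = (\<Sum>i=0..m. if i = q then a_tilde M Z j i else 0)"
      using q assms by (intro sum.cong) auto
    also have "\<dots> = a_tilde M Z j q"
      using q assms by simp
    finally show ?thesis using q assms by simp
  next
    case False
    then show ?thesis by (auto intro!: sum.neutral)
  qed
  finally show ?thesis .
qed

lemma g_tilde_trunc_Suc: "g_tilde_trunc M Z (Suc l) = g_tilde_trunc M Z l * S_tilde M Z (Suc l)"
  by (simp add: g_tilde_trunc_def)

lemma g_tilde_trunc_nth_stable: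
  assumes a0: "\<And>j. j \<ge> 1 \<Longrightarrow> a_prob M Z j 0 > 0" and "n \<le> m"
  shows "g_tilde_trunc M Z m $ n = g_tilde_trunc M Z n $ n"
  using \<open>n \<le> m\<close>
proof (induction m rule: dec_induct)
  case (step m)
  have "S_tilde M Z (Suc m) $ i = (if i = 0 then 1 else 0)" if "i \<le> n" for i
  proof -
    have "\<not> Suc m dvd i" if "i \<noteq> 0"
      using dvd_imp_le[of "Suc m" i] that \<open>i \<le> n\<close> step.hyps by auto
    moreover have "a_tilde M Z (Suc m) 0 = 1"
      using a0[of "Suc m"] by (simp add: a_tilde_def)
    ultimately show ?thesis by (auto simp: S_tilde_nth)
  qed
  then have "g_tilde_trunc M Z (Suc m) $ n
      = (\<Sum>i=0..n. if i = n then g_tilde_trunc M Z m $ i else 0)"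
    unfolding g_tilde_trunc_Suc fps_mult_nth by (intro sum.cong) auto
  then show ?case using step.IH by simp
qed simp

lemma g_tilde_trunc_nth_0:
  assumes a0: "\<And>j. j \<ge> 1 \<Longrightarrow> a_prob M Z j 0 > 0"
  shows "g_tilde_trunc M Z l $ 0 = 1"
proof -
  have "g_tilde_trunc M Z l $ 0 = g_tilde_trunc M Z 0 $ 0"
    by (rule g_tilde_trunc_nth_stable[OF a0]) auto
  then show ?thesis by (simp add: g_tilde_trunc_def)
qed

lemma g_tilde_has_prod:
  assumes a0: "\<And>j. j \<ge> 1 \<Longrightarrow> a_prob M Z j 0 > 0"
  shows "(\<lambda>j. S_tilde M Z (Suc j)) has_prod g_tilde M Z"
    and "g_tilde M Z $ n = g_tilde_trunc M Z n $ n"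
proof -
  define G where "G = Abs_fps (\<lambda>n. g_tilde_trunc M Z n $ n)"
  have eq: "(\<Prod>i\<le>m. S_tilde M Z (Suc i)) = g_tilde_trunc M Z (Suc m)" for m
  proof (induction m)
    case 0
    show ?case by (simp add: g_tilde_trunc_def)
  next
    case (Suc m)
    then show ?case by (simp only: prod.atMost_Suc g_tilde_trunc_Suc[of M Z "Suc m"])
  qed
  have lim: "(\<lambda>m. \<Prod>i\<le>m. S_tilde M Z (Suc i)) \<longlonglongrightarrow> G"
    unfolding eq
  proof (rule tendsto_fpsI)
    fix n
    show "\<forall>\<^sub>F m in sequentially. g_tilde_trunc M Z (Suc m) $ n = G $ n"
      using eventually_ge_at_top[of n]
    proof eventually_elim
      case (elim m)
      have "g_tilde_trunc M Z (Suc m) $ n = g_tilde_trunc M Z n $ n"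
        by (rule g_tilde_trunc_nth_stable[OF a0]) (use elim in auto)
      then show ?case by (simp add: G_def)
    qed
  qed
  have "G $ 0 = 1"
    using g_tilde_trunc_nth_0[OF a0, of 0] by (simp add: G_def)
  then have "G \<noteq> 0" by auto
  with lim have prod: "(\<lambda>j. S_tilde M Z (Suc j)) has_prod G"
    by (simp add: has_prod_def raw_has_prod_def)
  then have "g_tilde M Z = G"
    unfolding g_tilde_def by (rule has_prod_unique[symmetric])
  with prod show "(\<lambda>j. S_tilde M Z (Suc j)) has_prod g_tilde M Z"
    and "g_tilde M Z $ n = g_tilde_trunc M Z n $ n"
    by (simp_all add: G_def)
qed

end

theory Submission
  imports Defs
begin

text \<open>
  Let \<open>X = (Z\<^sub>1, \<dots>, Z\<^sub>l)\<close>, let \<open>T = \<Sum>j\<le>l. j Z\<^sub>j\<close>, and put \<open>f = 1 / g\<^sub>l\<close>, where \<open>g\<^sub>l\<close> is the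
  product of the first \<open>l\<close> series and \<open>g\<close> the full product. By independence
  the law of \<open>X\<close> conditioned on the total size \<open>n\<close> reweights the event \<open>T = m\<close> by the factor
  \<open>(f g)[n - m] / (A g[n])\<close>, where \<open>A = \<Prod>j\<le>l. P(Z\<^sub>j = 0)\<close>. Since \<open>g\<close> is in \<open>RT\<^sub>\<rho>\<close> and \<open>f\<close> has
  radius of convergence larger than \<open>\<rho>\<close>, Schur's theorem shows that this factor tends to
  \<open>f(\<rho>) \<rho>\<^sup>m / A\<close>. If \<open>f(\<rho>) = 0\<close>, all mass escapes to infinity. If \<open>f(\<rho>) > 0\<close>, the limiting masses
  \<open>g\<^sub>l[m] \<rho>\<^sup>m f(\<rho>)\<close> have sum at most \<open>1\<close>; so \<open>g\<^sub>l\<close> converges absolutely at \<open>\<rho>\<close>, the Cauchy product gives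
  \<open>g\<^sub>l(\<rho>) f(\<rho>) = 1\<close>, no mass is lost, and convergence of the masses yields weak convergence.
\<close>

section \<open>Coefficient ratios and Schur's theorem\<close>

text \<open>The ratio across \<open>m\<close> steps telescopes into \<open>m\<close> consecutive
  ratios, each tending to \<rho>. Truncation of \<open>n - m\<close> affects only
  \<open>n < m\<close>, hence not the limit.\<close>

lemma tendsto_ratio_power:
  fixes d :: "nat \<Rightarrow> real"
  assumes pos: "\<And>n. d n > 0" and lim: "(\<lambda>n. d n / d (Suc n)) \<longlonglongrightarrow> \<rho>"
  shows "(\<lambda>n. d (n - m) / d n) \<longlonglongrightarrow> \<rho> ^ m"
proof -
  have "(\<lambda>n. d n / d (n + m)) \<longlonglongrightarrow> \<rho> ^ m"
  proof (induction m)
    case 0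
    have "d n \<noteq> 0" for n using pos[of n] by simp
    then show ?case by simp
  next
    case (Suc m)
    have "(\<lambda>n. d n / d (n + m) * (d (n + m) / d (Suc (n + m)))) \<longlonglongrightarrow> \<rho> ^ m * \<rho>"
      by (intro tendsto_mult Suc LIMSEQ_ignore_initial_segment[OF lim])
    moreover have "d n / d (n + m) * (d (n + m) / d (Suc (n + m))) = d n / d (n + Suc m)" for n
      using pos[of "n + m"] by simp
    ultimately show ?case by (simp only: power_Suc2)
  qed
  then show ?thesis
    using LIMSEQ_offset[of "\<lambda>n. d (n - m) / d n" m "\<rho> ^ m"] by simp
qed

text \<open>Since \<open>d n / d (Suc n) < r\<close> eventually, \<open>d n * r ^ n\<close> is
  nondecreasing from some \<open>N\<close> on; the finitely many earlier values only cost a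
  constant. The bound is uniform in \<open>k\<close> and serves as the majorant in Schur's
  theorem.\<close>

lemma ratio_geometric_bound:
  fixes d :: "nat \<Rightarrow> real"
  assumes pos: "\<And>n. d n > 0" and lim: "(\<lambda>n. d n / d (Suc n)) \<longlonglongrightarrow> \<rho>"
    and r: "r > \<rho>" "r > 0"
  obtains K N where "K > 0" and "\<And>k n. k \<le> n \<Longrightarrow> n \<ge> N \<Longrightarrow> d (n - k) / d n \<le> K * r ^ k"
proof -
  define u where "u n = d n * r ^ n" for n
  have upos: "u n > 0" for n using pos r by (simp add: u_def)
  obtain N where N: "d n / d (Suc n) < r" if "n \<ge> N" for n
    using order_tendstoD(2)[OF lim r(1)] by (auto simp: eventually_sequentially)
  have mono: "u i \<le> u n" if "N \<le> i" "i \<le> n" for i n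
    using that(2)
  proof (induction n rule: dec_induct)
    case (step n)
    have "d n \<le> r * d (Suc n)"
      using N[of n] that step pos[of "Suc n"] by (simp add: field_simps)
    then have "u n \<le> u (Suc n)"
      using r by (simp add: u_def mult.assoc mult.left_commute mult_right_mono)
    with step show ?case by simp
  qed simp
  \<comment> \<open>The summand \<open>1\<close> covers indices \<open>i \<ge> N\<close>, where
    monotonicity suffices; the sum dominates each single \<open>u i / u N\<close> with
    \<open>i < N\<close>.\<close>
  define K where "K = 1 + (\<Sum>i\<le>N. u i / u N)"
  have s0: "(\<Sum>i\<le>N. u i / u N) \<ge> 0"
    by (intro sum_nonneg divide_nonneg_nonneg less_imp_le[OF upos])
  have K1: "K \<ge> 1" using s0 by (simp add: K_def)
  have bound: "u i \<le> K * u n" if "i \<le> n" "N \<le> n" for i n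
  proof (cases "N \<le> i")
    case True
    with mono[of i n] that have "u i \<le> 1 * u n" by simp
    also have "\<dots> \<le> K * u n" using K1 upos[of n] by (intro mult_right_mono) auto
    finally show ?thesis .
  next
    case False
    have "u i / u N \<le> (\<Sum>i\<le>N. u i / u N)"
      using False by (intro member_le_sum divide_nonneg_nonneg less_imp_le[OF upos]) auto
    then have "u i / u N \<le> K" by (simp add: K_def)
    then have "u i \<le> K * u N" using upos[of N] by (simp add: field_simps)
    also have "\<dots> \<le> K * u n" using mono[of N n] that K1 by simp
    finally show ?thesis .
  qed
  have "d (n - k) / d n \<le> K * r ^ k" if "k \<le> n" "n \<ge> N" for k n
  proof -
    have "r ^ n = r ^ (n - k) * r ^ k" using that by (simp flip: power_add)
    then have "d (n - k) / d n = u (n - k) / u n * r ^ k"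
      using pos[of n] r by (simp add: u_def)
    also have "\<dots> \<le> K * r ^ k"
      using bound[of "n - k" n] that upos[of n] r
      by (intro mult_right_mono) (auto simp: field_simps)
    finally show ?thesis .
  qed
  then show ?thesis using that[of K N] K1 by simp
qed

text \<open>Dominated convergence for series: the quotient is the sum over \<open>k\<close> of
  \<open>f $ k * (g $ (n - k) / g $ n)\<close>, whose terms tend to
  \<open>f $ k * \<rho> ^ k\<close>.\<close>

lemma Schur_fps_mult_nth_ratio_tendsto:
  fixes g f :: "real fps"
  assumes pos: "\<And>n. g $ n > 0" and lim: "(\<lambda>n. g $ n / g $ Suc n) \<longlonglongrightarrow> \<rho>"
    and "\<rho> \<ge> 0" and rad: "fps_conv_radius f > ereal \<rho>"
  shows "(\<lambda>n. (f * g) $ n / g $ n) \<longlonglongrightarrow> eval_fps f \<rho>"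
proof -
  \<comment> \<open>A radius strictly between \<rho> and the radius of convergence: above \<rho> for
    the geometric bound on the ratios, below the radius so that the majorant is summable.\<close>
  obtain r' where r': "ereal \<rho> < r'" "r' < fps_conv_radius f"
    using dense[OF rad] by blast
  then obtain r where r: "r' = ereal r" by (cases r') auto
  have r\<rho>: "r > \<rho>" "r > 0" using r r' \<open>\<rho> \<ge> 0\<close> by auto
  obtain K N where K: "K > 0"
    and KN: "\<And>k n. k \<le> n \<Longrightarrow> n \<ge> N \<Longrightarrow> g $ (n - k) / g $ n \<le> K * r ^ k"
    using ratio_geometric_bound[OF pos lim r\<rho>] by metis
  \<comment> \<open>Padding by zero for \<open>k > n\<close> turns the finite convolution into a
    series over all \<open>k\<close>, as Tannery's theorem requires.\<close>
  define a where "a k n = (if k \<le> n then f $ k * (g $ (n - k) / g $ n) else 0)" for k n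
  have "(\<lambda>n. suminf (\<lambda>k. a k n)) \<longlonglongrightarrow> suminf (\<lambda>k. f $ k * \<rho> ^ k)"
  proof (rule tannerys_theorem[THEN conjunct2, THEN conjunct2])
    fix k
    have "(\<lambda>n. f $ k * (g $ (n - k) / g $ n)) \<longlonglongrightarrow> f $ k * \<rho> ^ k"
      by (intro tendsto_mult tendsto_const tendsto_ratio_power[OF pos lim])
    then show "a k \<longlonglongrightarrow> f $ k * \<rho> ^ k"
      by (rule Lim_transform_eventually)
        (use eventually_ge_at_top[of k] in eventually_elim, simp add: a_def)
  next
    have "norm (a k n) \<le> K * norm (f $ k * r ^ k)" if "n \<ge> N" for k n
    proof (cases "k \<le> n")
      case True
      have "norm (a k n) = \<bar>f $ k\<bar> * (g $ (n - k) / g $ n)"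
        using True pos[THEN less_imp_le] by (simp add: a_def abs_mult)
      also have "\<dots> \<le> \<bar>f $ k\<bar> * (K * r ^ k)"
        using KN[OF True that] by (intro mult_left_mono) auto
      finally show ?thesis using r\<rho> by (simp add: abs_mult mult_ac)
    qed (use K in \<open>simp add: a_def\<close>)
    then show "\<forall>\<^sub>F (k, n) in sequentially \<times>\<^sub>F sequentially. norm (a k n) \<le> K * norm (f $ k * r ^ k)"
      unfolding eventually_prod_filter
      by (intro exI[of _ "\<lambda>_. True"] exI[of _ "\<lambda>n. n \<ge> N"]) (simp add: eventually_ge_at_top)
  next
    have "summable (\<lambda>k. norm (f $ k * r ^ k))"
      by (rule norm_summable_fps) (use r r' r\<rho> in simp)
    then show "summable (\<lambda>k. K * norm (f $ k * r ^ k))" by (rule summable_mult)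
  qed simp
  moreover have "suminf (\<lambda>k. a k n) = (f * g) $ n / g $ n" for n
  proof -
    have "suminf (\<lambda>k. a k n) = (\<Sum>k\<le>n. a k n)"
      by (rule suminf_finite) (auto simp: a_def)
    also have "\<dots> = (f * g) $ n / g $ n"
      by (simp add: a_def fps_mult_nth atLeast0AtMost sum_divide_distrib)
    finally show ?thesis .
  qed
  ultimately show ?thesis by (simp add: eval_fps_def)
qed

section \<open>Limits of weighted sums\<close>

text \<open>Fatou's inequality for sums: some finite partial sum of the limit already exceeds
  \<open>a\<close>, finite sums pass to the limit, and the remaining terms are nonnegative.\<close>

lemma sum_tendsto_lower:
  fixes q :: "nat \<Rightarrow> nat \<Rightarrow> real"
  assumes lim: "\<And>m. (\<lambda>n. q n m) \<longlonglongrightarrow> p m" and q0: "\<And>n m. q n m \<ge> 0"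
    and G0: "\<And>m. G m \<ge> 0" and sums: "(\<lambda>m. G m * p m) sums S" and a: "a < S"
  shows "\<forall>\<^sub>F n in sequentially. a < (\<Sum>m\<le>n. G m * q n m)"
proof -
  have "\<forall>\<^sub>F k in sequentially. a < (\<Sum>m<k. G m * p m)"
    using order_tendstoD(1)[OF sums[unfolded sums_def] a] .
  then obtain k where k: "a < (\<Sum>m<k. G m * p m)"
    by (auto simp: eventually_sequentially)
  have "(\<lambda>n. \<Sum>m<k. G m * q n m) \<longlonglongrightarrow> (\<Sum>m<k. G m * p m)"
    by (intro tendsto_sum tendsto_mult tendsto_const lim)
  from order_tendstoD(1)[OF this k] eventually_ge_at_top[of k]
  show ?thesis
  proof eventually_elim
    case (elim n)
    have "(\<Sum>m<k. G m * q n m) \<le> (\<Sum>m\<le>n. G m * q n m)"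
      by (rule sum_mono2) (use elim q0 G0 in auto)
    with elim show ?case by simp
  qed
qed

text \<open>No mass escapes in the limit, so Fatou's inequality applied to \<open>B * t + F\<close> and \<open>B * t - F\<close>, both
  nonnegative, gives the two bounds.\<close>

lemma sum_tendsto_Scheffe:
  fixes q :: "nat \<Rightarrow> nat \<Rightarrow> real"
  assumes lim: "\<And>m. (\<lambda>n. q n m) \<longlonglongrightarrow> p m" and q0: "\<And>n m. q n m \<ge> 0"
    and one: "\<forall>\<^sub>F n in sequentially. (\<Sum>m\<le>n. t m * q n m) = 1"
    and tp: "(\<lambda>m. t m * p m) sums 1"
    and F: "\<And>m. \<bar>F m\<bar> \<le> B * t m" and S: "(\<lambda>m. F m * p m) sums S"
  shows "(\<lambda>n. \<Sum>m\<le>n. F m * q n m) \<longlonglongrightarrow> S"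
proof (rule order_tendstoI)
  fix a assume "a < S"
  \<comment> \<open>The \<open>B * t\<close> part contributes exactly \<open>B\<close> both for
    large \<open>n\<close> and in the limit, so it cancels and leaves a bound for \<open>F\<close>
    alone.\<close>
  have "\<forall>\<^sub>F n in sequentially. B + a < (\<Sum>m\<le>n. (B * t m + F m) * q n m)"
  proof (rule sum_tendsto_lower[OF lim q0])
    show "0 \<le> B * t m + F m" for m using F[of m] by linarith
    show "(\<lambda>m. (B * t m + F m) * p m) sums (B * 1 + S)"
      using sums_add[OF sums_mult[OF tp, of B] S] by (simp add: algebra_simps)
  qed (use \<open>a < S\<close> in simp)
  with one show "\<forall>\<^sub>F n in sequentially. a < (\<Sum>m\<le>n. F m * q n m)"
  proof eventually_elim
    case (elim n)
    have "(\<Sum>m\<le>n. (B * t m + F m) * q n m) = B * (\<Sum>m\<le>n. t m * q n m) + (\<Sum>m\<le>n. F m * q n m)"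
      by (simp add: algebra_simps sum.distrib sum_distrib_left)
    with elim show ?case by simp
  qed
next
  fix a assume "S < a"
  have "\<forall>\<^sub>F n in sequentially. B - a < (\<Sum>m\<le>n. (B * t m - F m) * q n m)"
  proof (rule sum_tendsto_lower[OF lim q0])
    show "0 \<le> B * t m - F m" for m using F[of m] by linarith
    show "(\<lambda>m. (B * t m - F m) * p m) sums (B * 1 - S)"
      using sums_diff[OF sums_mult[OF tp, of B] S] by (simp add: algebra_simps)
  qed (use \<open>S < a\<close> in simp)
  with one show "\<forall>\<^sub>F n in sequentially. (\<Sum>m\<le>n. F m * q n m) < a"
  proof eventually_elim
    case (elim n)
    have "(\<Sum>m\<le>n. (B * t m - F m) * q n m) = B * (\<Sum>m\<le>n. t m * q n m) - (\<Sum>m\<le>n. F m * q n m)"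
      by (simp add: algebra_simps sum_subtractf sum_distrib_left)
    with elim show ?case by simp
  qed
qed

section \<open>Measurability of the test functions\<close>

text \<open>This links the product topology of the test functions with the product sigma-algebra of
  the laws. On the full product over a countable index type the two are compatible, so
  \<open>f\<close> is first extended to all functions by restriction of the argument.\<close>

lemma borel_measurable_continuous_map_powertop:
  fixes f :: "('i::countable \<Rightarrow> real) \<Rightarrow> real"
  assumes "continuous_map (powertop_real I) euclideanreal f"
  shows "f \<in> borel_measurable (\<Pi>\<^sub>M j\<in>I. borel)"
proof -
  define g where "g x = f (restrict x I)" for x
  have "continuous_map (powertop_real UNIV) (powertop_real I) (\<lambda>x. restrict x I)"
    by (auto simp: continuous_map_componentwise intro!: continuous_map_product_projection)
  from continuous_map_compose[OF this assms]
  have "continuous_map euclidean euclideanreal g"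
    by (simp add: g_def o_def euclidean_product_topology)
  then have "g \<in> borel_measurable borel"
    by (intro borel_measurable_continuous_onI) (simp add: continuous_map_iff_continuous2)
  then have "g \<in> borel_measurable (\<Pi>\<^sub>M j\<in>UNIV. borel)"
    using measurable_cong_sets[OF sets_PiM_equal_borel refl] by blast
  \<comment> \<open>Points of the product over \<open>I\<close> are extensional; filling in
    \<open>undefined\<close> outside \<open>I\<close> embeds them measurably into the full product,
    and restriction undoes it.\<close>
  moreover have "(\<lambda>x i. if i \<in> I then x i else undefined) \<in> (\<Pi>\<^sub>M j\<in>I. borel) \<rightarrow>\<^sub>M (\<Pi>\<^sub>M j\<in>UNIV. (borel :: real measure))"
  proof (rule measurable_PiM_single')
    fix i
    show "(\<lambda>x. if i \<in> I then x i else undefined) \<in> (\<Pi>\<^sub>M j\<in>I. borel) \<rightarrow>\<^sub>M (borel :: real measure)"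
      by (cases "i \<in> I") auto
  qed auto
  ultimately have "(\<lambda>x. g (\<lambda>i. if i \<in> I then x i else undefined)) \<in> borel_measurable (\<Pi>\<^sub>M j\<in>I. borel)"
    by (rule measurable_compose[rotated])
  then show ?thesis
  proof (subst measurable_cong)
    fix x :: "'i \<Rightarrow> real" assume "x \<in> space (\<Pi>\<^sub>M j\<in>I. borel)"
    then have "restrict (\<lambda>i. if i \<in> I then x i else undefined) I = x"
      by (auto simp: space_PiM PiE_def extensional_def)
    then show "f x = g (\<lambda>i. if i \<in> I then x i else undefined)"
      by (simp add: g_def)
  qed
qed

section \<open>Independent counts, weights and generating functions\<close>

locale independent_counts = prob_space M for M :: "'a measure" +
  fixes Z :: "nat \<Rightarrow> 'a \<Rightarrow> nat"
  assumes indep: "indep_vars (\<lambda>_. count_space UNIV) Z {1..}"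
    and a0: "\<And>j. j \<ge> 1 \<Longrightarrow> a_prob M Z j 0 > 0"
begin

text \<open>For \<open>J = {1..l}\<close> this is the \<open>T\<close> of the overview; a general
  index set also admits the tail block \<open>{l<..n}\<close>.\<close>

definition weight :: "nat set \<Rightarrow> 'a \<Rightarrow> nat" where
  "weight J \<omega> = (\<Sum>j\<in>J. j * Z j \<omega>)"

abbreviation Zvec :: "nat set \<Rightarrow> 'a \<Rightarrow> nat \<Rightarrow> nat" where
  "Zvec J \<omega> \<equiv> \<lambda>j\<in>J. Z j \<omega>"

lemma measurable_Z: "j \<ge> 1 \<Longrightarrow> Z j \<in> M \<rightarrow>\<^sub>M count_space UNIV"
  using indep by (auto simp: indep_vars_def)

lemma prod_a_prob_0_pos: "J \<subseteq> {1..} \<Longrightarrow> (\<Prod>j\<in>J. a_prob M Z j 0) > 0"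
  by (intro prod_pos a0) auto

text \<open>A finite product of count spaces over \<open>nat\<close> is again a count space, hence
  discrete.\<close>

lemma measurable_fun_PiM_nat:
  fixes u :: "(nat \<Rightarrow> nat) \<Rightarrow> 'b"
  assumes "finite J" "\<And>x. u x \<in> space N"
  shows "u \<in> (\<Pi>\<^sub>M j\<in>J. count_space UNIV) \<rightarrow>\<^sub>M N"
  using assms by (subst count_space_PiM_finite) auto

lemma measurable_fun_Zvec:
  fixes u :: "(nat \<Rightarrow> nat) \<Rightarrow> 'b"
  assumes "finite J" "J \<subseteq> {1..}" "\<And>x. u x \<in> space N"
  shows "(\<lambda>\<omega>. u (Zvec J \<omega>)) \<in> M \<rightarrow>\<^sub>M N"
proof (rule measurable_compose[OF _ measurable_fun_PiM_nat[OF assms(1,3)]])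
  show "Zvec J \<in> M \<rightarrow>\<^sub>M (\<Pi>\<^sub>M j\<in>J. count_space UNIV)"
    using assms(2) by (intro measurable_restrict measurable_Z) auto
qed

lemma weight_Zvec: "J \<subseteq> K \<Longrightarrow> weight J \<omega> = (\<Sum>j\<in>J. j * Zvec K \<omega> j)"
  unfolding weight_def by (intro sum.cong) auto

lemma measurable_weight:
  assumes "finite J" "J \<subseteq> {1..}"
  shows "weight J \<in> M \<rightarrow>\<^sub>M count_space UNIV"
proof -
  have "(\<lambda>\<omega>. (\<lambda>x. \<Sum>j\<in>J. j * x j) (Zvec J \<omega>)) \<in> M \<rightarrow>\<^sub>M count_space UNIV"
    using assms by (intro measurable_fun_Zvec) auto
  then show ?thesis by (subst measurable_cong[OF weight_Zvec[OF order_refl]])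
qed

lemma integrable_fun_Zvec:
  fixes u :: "(nat \<Rightarrow> nat) \<Rightarrow> real"
  assumes "finite J" "J \<subseteq> {1..}" "\<And>x. \<bar>u x\<bar> \<le> B"
  shows "integrable M (\<lambda>\<omega>. u (Zvec J \<omega>))"
  using assms by (intro integrable_const_bound[of _ B] measurable_fun_Zvec) auto

lemma expectation_of_bool: "expectation (\<lambda>\<omega>. of_bool (P \<omega>)) = prob {\<omega> \<in> space M. P \<omega>}"
proof -
  have "expectation (\<lambda>\<omega>. of_bool (P \<omega>)) = expectation (indicator {\<omega> \<in> space M. P \<omega>})"
    by (intro Bochner_Integration.integral_cong) (auto simp: indicator_def)
  also have "\<dots> = prob ({\<omega> \<in> space M. P \<omega>} \<inter> space M)" by simp
  also have "{\<omega> \<in> space M. P \<omega>} \<inter> space M = {\<omega> \<in> space M. P \<omega>}" by auto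
  finally show ?thesis .
qed

text \<open>Disjoint blocks of an independent family are independent; boundedness supplies the
  integrability for the product formula.\<close>

lemma expectation_mult_blocks:
  fixes u v :: "(nat \<Rightarrow> nat) \<Rightarrow> real"
  assumes A: "finite A" "A \<subseteq> {1..}" and B: "finite B" "B \<subseteq> {1..}" and disj: "A \<inter> B = {}"
    and u: "\<And>x. \<bar>u x\<bar> \<le> U" and v: "\<And>x. \<bar>v x\<bar> \<le> V"
  shows "integrable M (\<lambda>\<omega>. u (Zvec A \<omega>) * v (Zvec B \<omega>))"
    and "expectation (\<lambda>\<omega>. u (Zvec A \<omega>) * v (Zvec B \<omega>))
       = expectation (\<lambda>\<omega>. u (Zvec A \<omega>)) * expectation (\<lambda>\<omega>. v (Zvec B \<omega>))"
proof -
  have "indep_var borel (u \<circ> Zvec A) borel (v \<circ> Zvec B)"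
    by (rule indep_var_compose[OF indep_var_restrict[OF indep disj A(2) B(2)]])
      (use A B in \<open>auto intro: measurable_fun_PiM_nat\<close>)
  then have "indep_var borel (\<lambda>\<omega>. u (Zvec A \<omega>)) borel (\<lambda>\<omega>. v (Zvec B \<omega>))"
    by (simp add: o_def)
  from indep_var_integrable[OF this] indep_var_lebesgue_integral[OF this]
    integrable_fun_Zvec[OF A, of u U, OF u] integrable_fun_Zvec[OF B, of v V, OF v]
  show "integrable M (\<lambda>\<omega>. u (Zvec A \<omega>) * v (Zvec B \<omega>))"
    and "expectation (\<lambda>\<omega>. u (Zvec A \<omega>) * v (Zvec B \<omega>))
       = expectation (\<lambda>\<omega>. u (Zvec A \<omega>)) * expectation (\<lambda>\<omega>. v (Zvec B \<omega>))"
    by auto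
qed

text \<open>Partitioning by the value \<open>m\<close> of \<open>weight A\<close> leaves weight
  \<open>n - m\<close> for the independent block \<open>B\<close>. With \<open>u = 1\<close> this is
  the convolution of weights; with a test function it computes conditional expectations.\<close>

lemma expectation_weight_split:
  fixes u :: "(nat \<Rightarrow> nat) \<Rightarrow> real"
  assumes A: "finite A" "A \<subseteq> {1..}" and B: "finite B" "B \<subseteq> {1..}" and disj: "A \<inter> B = {}"
    and u: "\<And>x. \<bar>u x\<bar> \<le> U"
  shows "expectation (\<lambda>\<omega>. u (Zvec A \<omega>) * of_bool (weight (A \<union> B) \<omega> = n))
       = (\<Sum>m\<le>n. expectation (\<lambda>\<omega>. u (Zvec A \<omega>) * of_bool (weight A \<omega> = m))
                  * prob {\<omega> \<in> space M. weight B \<omega> = n - m})"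
proof -
  \<comment> \<open>The events on the weights are rewritten as functions of \<open>Zvec A\<close>
    and \<open>Zvec B\<close>, the form to which block independence applies.\<close>
  define u' where "u' m x = u x * of_bool ((\<Sum>j\<in>A. j * x j) = m)" for m x
  define v where "v m x = (of_bool ((\<Sum>j\<in>B. j * x j) = n - m) :: real)" for m x
  have u': "u' m (Zvec A \<omega>) = u (Zvec A \<omega>) * of_bool (weight A \<omega> = m)" for m \<omega>
    using weight_Zvec[OF order_refl[of A], of \<omega>] by (simp add: u'_def)
  have v: "v m (Zvec B \<omega>) = of_bool (weight B \<omega> = n - m)" for m \<omega>
    using weight_Zvec[OF order_refl[of B], of \<omega>] by (simp add: v_def)
  have u'_bd: "\<bar>u' m x\<bar> \<le> U" for m x
    using u[of x] by (auto simp: u'_def)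
  have v_bd: "\<bar>v m x\<bar> \<le> 1" for m x by (simp add: v_def)
  have "u (Zvec A \<omega>) * of_bool (weight (A \<union> B) \<omega> = n)
      = (\<Sum>m\<le>n. u' m (Zvec A \<omega>) * v m (Zvec B \<omega>))" for \<omega>
  proof -
    have "weight (A \<union> B) \<omega> = weight A \<omega> + weight B \<omega>"
      unfolding weight_def by (intro sum.union_disjoint A B disj)
    \<comment> \<open>The condition \<open>weight A \<omega> \<le> n\<close> makes the
      natural-number subtraction exact.\<close>
    then have eq: "weight (A \<union> B) \<omega> = n \<longleftrightarrow> weight A \<omega> \<le> n \<and> weight B \<omega> = n - weight A \<omega>"
      by auto
    have "(\<Sum>m\<le>n. u' m (Zvec A \<omega>) * v m (Zvec B \<omega>))
        = (\<Sum>m\<le>n. if m = weight A \<omega> then u (Zvec A \<omega>) * of_bool (weight B \<omega> = n - m) else 0)"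
      unfolding u' v by (intro sum.cong) auto
    also have "\<dots> = u (Zvec A \<omega>) * of_bool (weight (A \<union> B) \<omega> = n)"
      unfolding eq by (simp add: sum.delta')
    finally show ?thesis ..
  qed
  then have "expectation (\<lambda>\<omega>. u (Zvec A \<omega>) * of_bool (weight (A \<union> B) \<omega> = n))
      = (\<Sum>m\<le>n. expectation (\<lambda>\<omega>. u' m (Zvec A \<omega>) * v m (Zvec B \<omega>)))"
    using expectation_mult_blocks(1)[OF A B disj, of "u' m" U "v m" 1 for m, OF u'_bd v_bd]
    by (simp add: Bochner_Integration.integral_sum)
  also have "\<dots> = (\<Sum>m\<le>n. expectation (\<lambda>\<omega>. u' m (Zvec A \<omega>)) * expectation (\<lambda>\<omega>. v m (Zvec B \<omega>)))"
    using expectation_mult_blocks(2)[OF A B disj, of "u' m" U "v m" 1 for m, OF u'_bd v_bd]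
    by simp
  finally show ?thesis by (simp add: u' v expectation_of_bool)
qed

text \<open>Adding an index convolves the law of the weight with that of \<open>j * Z j\<close>,
  which is multiplication of power series; the factors \<open>a_prob M Z j 0\<close> undo the
  normalisation in \<open>a_tilde\<close>.\<close>

lemma prob_weight:
  assumes "finite J" "J \<subseteq> {1..}"
  shows "prob {\<omega> \<in> space M. weight J \<omega> = r}
       = (\<Prod>j\<in>J. a_prob M Z j 0) * (\<Prod>j\<in>J. S_tilde M Z j) $ r"
  using assms
proof (induction J arbitrary: r rule: finite_induct)
  case empty
  then show ?case by (simp add: weight_def prob_space)
next
  case (insert j J)
  have j: "j \<ge> 1" and J: "J \<subseteq> {1..}" using insert.prems by auto
  have "prob {\<omega> \<in> space M. weight {j} \<omega> = i} = a_prob M Z j 0 * S_tilde M Z j $ i" for i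
  proof (cases "j dvd i")
    case True
    then have "{\<omega> \<in> space M. weight {j} \<omega> = i} = {\<omega> \<in> space M. Z j \<omega> = i div j}"
      using j by (auto simp: weight_def)
    then show ?thesis using True j a0[OF j] by (simp add: S_tilde_nth a_tilde_def a_prob_def)
  next
    case False
    then have empty: "{\<omega> \<in> space M. weight {j} \<omega> = i} = {}" by (auto simp: weight_def)
    show ?thesis unfolding empty using False j by (simp add: S_tilde_nth)
  qed
  moreover have "prob {\<omega> \<in> space M. weight (insert j J) \<omega> = r}
      = (\<Sum>m\<le>r. prob {\<omega> \<in> space M. weight {j} \<omega> = m} * prob {\<omega> \<in> space M. weight J \<omega> = r - m})"
    using expectation_weight_split[of "{j}" J "\<lambda>_. 1" 1 r] insert j J
    by (simp add: expectation_of_bool)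
  ultimately show ?case
    using insert J by (simp add: fps_mult_nth atLeast0AtMost sum_distrib_left mult_ac)
qed

lemma g_tilde_trunc_nth: "r \<le> n \<Longrightarrow> g_tilde_trunc M Z n $ r = g_tilde M Z $ r"
  using g_tilde_trunc_nth_stable[of M Z r n] g_tilde_has_prod(2)[of M Z r] a0 by simp

lemma prob_weight_initial:
  "prob {\<omega> \<in> space M. weight {1..l} \<omega> = r} = (\<Prod>j=1..l. a_prob M Z j 0) * g_tilde_trunc M Z l $ r"
  by (subst prob_weight) (auto simp: g_tilde_trunc_def)

lemma c_prob_eq: "c_prob M Z n = (\<Prod>j=1..n. a_prob M Z j 0) * g_tilde M Z $ n"
  using prob_weight_initial[of n n] g_tilde_trunc_nth[of n n]
  by (simp add: c_prob_def size_event_def weight_def)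

text \<open>Dividing the product up to \<open>n\<close> by its first \<open>l\<close> factors leaves
  the tail. Up to degree \<open>n\<close> the truncated product agrees with \<open>g_tilde\<close>,
  so the series on the right can be chosen independent of \<open>n\<close>, as Schur's theorem
  demands.\<close>

lemma prob_weight_tail:
  assumes "l \<le> n" "r \<le> n"
  shows "prob {\<omega> \<in> space M. weight {l<..n} \<omega> = r}
       = (\<Prod>j\<in>{l<..n}. a_prob M Z j 0) * (inverse (g_tilde_trunc M Z l) * g_tilde M Z) $ r"
proof -
  let ?P = "\<Prod>j\<in>{l<..n}. S_tilde M Z j"
  have "{1..n} = {1..l} \<union> {l<..n}" using assms by auto
  then have "g_tilde_trunc M Z n = g_tilde_trunc M Z l * ?P"
    unfolding g_tilde_trunc_def by (simp only:) (rule prod.union_disjoint, auto)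
  then have "inverse (g_tilde_trunc M Z l) * g_tilde_trunc M Z n = ?P"
    using inverse_mult_eq_1[of "g_tilde_trunc M Z l"] g_tilde_trunc_nth_0[OF a0, of l]
    by (simp flip: mult.assoc)
  moreover have "(inverse (g_tilde_trunc M Z l) * g_tilde_trunc M Z n) $ r
      = (inverse (g_tilde_trunc M Z l) * g_tilde M Z) $ r"
    unfolding fps_mult_nth using assms by (intro sum.cong) (auto simp: g_tilde_trunc_nth)
  ultimately show ?thesis by (subst prob_weight) auto
qed

lemma sets_size_event: "size_event M Z n \<in> sets M"
proof -
  have "size_event M Z n = weight {1..n} -` {n} \<inter> space M"
    by (auto simp: size_event_def weight_def)
  then show ?thesis using measurable_sets[OF measurable_weight[of "{1..n}"], of "{n}"] by auto
qed

text \<open>Both push-forwards are unwound, and conditioning becomes a density: the indicator of the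
  size event divided by \<open>c_prob M Z n\<close>.\<close>

lemma integral_initial_law:
  assumes c: "c_prob M Z n > 0" and "l \<le> n" and f: "f \<in> borel_measurable (\<Pi>\<^sub>M j\<in>{1..l}. borel)"
  shows "integral\<^sup>L (initial_law M Z l n) f
       = expectation (\<lambda>\<omega>. f (\<lambda>j\<in>{1..l}. real (Z j \<omega>)) * of_bool (weight {1..n} \<omega> = n)) / c_prob M Z n"
proof -
  let ?Q = "uniform_measure M (size_event M Z n)"
  let ?e = "\<lambda>k. \<lambda>j\<in>{1..l}. real (k j)"
  have e: "?e \<in> (\<Pi>\<^sub>M j\<in>{1..n}. count_space UNIV) \<rightarrow>\<^sub>M (\<Pi>\<^sub>M j\<in>{1..l}. borel)"
    by (intro measurable_fun_PiM_nat) (simp_all add: space_PiM)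
  have Zn: "Zvec {1..n} \<in> M \<rightarrow>\<^sub>M (\<Pi>\<^sub>M j\<in>{1..n}. count_space UNIV)"
    by (intro measurable_restrict measurable_Z) auto
  have Zn': "Zvec {1..n} \<in> ?Q \<rightarrow>\<^sub>M (\<Pi>\<^sub>M j\<in>{1..n}. count_space UNIV)"
    using Zn by (simp only: measurable_cong_sets[OF sets_uniform_measure refl])
  have meas: "(\<lambda>\<omega>. f (?e (Zvec {1..n} \<omega>))) \<in> borel_measurable M"
    by (rule measurable_compose[OF measurable_compose[OF Zn e] f])
  have e': "?e \<in> counting_law M Z n \<rightarrow>\<^sub>M (\<Pi>\<^sub>M j\<in>{1..l}. borel)"
    unfolding counting_law_def measurable_distr_eq1 by (rule e)
  have "integral\<^sup>L (initial_law M Z l n) f = integral\<^sup>L (counting_law M Z n) (\<lambda>k. f (?e k))"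
    unfolding initial_law_def by (rule integral_distr[OF e' f])
  also have "\<dots> = integral\<^sup>L ?Q (\<lambda>\<omega>. f (?e (Zvec {1..n} \<omega>)))"
    unfolding counting_law_def by (rule integral_distr[OF Zn' measurable_compose[OF e f]])
  also have "?Q = density M (\<lambda>\<omega>. ennreal (indicator (size_event M Z n) \<omega> / c_prob M Z n))"
  proof -
    have "indicator (size_event M Z n) \<omega> / emeasure M (size_event M Z n)
        = ennreal (indicator (size_event M Z n) \<omega> / c_prob M Z n)" for \<omega>
      unfolding emeasure_eq_measure c_prob_def[symmetric]
      using divide_ennreal[OF _ c, of "indicator (size_event M Z n) \<omega>"]
      by (simp add: ennreal_indicator)
    then show ?thesis by (simp only: uniform_measure_def)
  qed
  also have "integral\<^sup>L \<dots> (\<lambda>\<omega>. f (?e (Zvec {1..n} \<omega>)))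
      = expectation (\<lambda>\<omega>. indicator (size_event M Z n) \<omega> / c_prob M Z n * f (?e (Zvec {1..n} \<omega>)))"
  proof (rule integral_real_density[OF _ _ meas])
    show "(\<lambda>\<omega>. indicator (size_event M Z n) \<omega> / c_prob M Z n) \<in> borel_measurable M"
      by (intro borel_measurable_divide borel_measurable_indicator sets_size_event borel_measurable_const)
    show "AE \<omega> in M. 0 \<le> indicator (size_event M Z n) \<omega> / c_prob M Z n"
      using c by (intro AE_I2) (simp add: indicator_def)
  qed
  also have "\<dots> = expectation (\<lambda>\<omega>. f (?e (\<lambda>j. Z j \<omega>)) * of_bool (weight {1..n} \<omega> = n) / c_prob M Z n)"
  proof (intro Bochner_Integration.integral_cong refl)
    fix \<omega> assume "\<omega> \<in> space M"
    have "?e (Zvec {1..n} \<omega>) = ?e (\<lambda>j. Z j \<omega>)" 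
      by (rule restrict_ext) (use \<open>l \<le> n\<close> in simp)
    moreover have "indicator (size_event M Z n) \<omega> = (of_bool (weight {1..n} \<omega> = n) :: real)"
      using \<open>\<omega> \<in> space M\<close> by (simp add: size_event_def weight_def indicator_def)
    ultimately show "indicator (size_event M Z n) \<omega> / c_prob M Z n * f (?e (Zvec {1..n} \<omega>))
        = f (?e (\<lambda>j. Z j \<omega>)) * of_bool (weight {1..n} \<omega> = n) / c_prob M Z n"
      by (simp only: times_divide_eq_left times_divide_eq_right mult.commute)
  qed
  finally show ?thesis by (simp only: integral_divide_zero)
qed

end

section \<open>Values at \<rho> and sums over the weight\<close>

text \<open>Only the inverse is assumed to converge beyond \<rho>. For \<open>g\<close> itself,
  nonnegative coefficients and bounded partial sums give absolute convergence at \<rho>, and the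
  Cauchy product of the two series is \<open>1\<close>.\<close>

lemma powser_at_boundary_inverse:
  fixes g :: "real fps"
  assumes g0: "g $ 0 \<noteq> 0" and nonneg: "\<And>n. g $ n \<ge> 0" and "\<rho> \<ge> 0"
    and rad: "fps_conv_radius (inverse g) > ereal \<rho>"
    and bounded: "\<And>k. (\<Sum>m<k. g $ m * \<rho> ^ m) \<le> C"
  shows "(\<lambda>m. g $ m * \<rho> ^ m * eval_fps (inverse g) \<rho>) sums 1"
proof -
  have summ: "summable (\<lambda>m. g $ m * \<rho> ^ m)"
    using nonneg \<open>\<rho> \<ge> 0\<close> bounded by (intro summableI_nonneg_bounded[of _ C]) auto
  then have "summable (\<lambda>m. norm (g $ m * \<rho> ^ m))"
    using nonneg \<open>\<rho> \<ge> 0\<close> by simp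
  moreover have "summable (\<lambda>m. norm (inverse g $ m * \<rho> ^ m))"
    using rad \<open>\<rho> \<ge> 0\<close> by (intro norm_summable_fps) simp
  ultimately have "(\<lambda>k. \<Sum>i\<le>k. (g $ i * \<rho> ^ i) * (inverse g $ (k - i) * \<rho> ^ (k - i))) sums
      ((\<Sum>m. g $ m * \<rho> ^ m) * eval_fps (inverse g) \<rho>)"
    unfolding eval_fps_def by (rule Cauchy_product_sums)
  also have "(\<lambda>k. \<Sum>i\<le>k. (g $ i * \<rho> ^ i) * (inverse g $ (k - i) * \<rho> ^ (k - i)))
      = (\<lambda>k. (g * inverse g) $ k * \<rho> ^ k)"
    unfolding fps_mult_nth atLeast0AtMost sum_distrib_right
    by (intro ext sum.cong refl) (simp add: mult_ac flip: power_add)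
  also have "\<dots> = (\<lambda>k. if k = 0 then 1 else 0)"
    using inverse_mult_eq_1[OF g0] by (auto simp: mult.commute[of g])
  finally have "(\<Sum>m. g $ m * \<rho> ^ m) * eval_fps (inverse g) \<rho> = 1"
    using sums_unique2[OF _ sums_single[of 0 "\<lambda>_. 1 :: real"]] by simp
  then show ?thesis
    using sums_mult2[OF summable_sums[OF summ], of "eval_fps (inverse g) \<rho>"] by simp
qed

context independent_counts
begin

lemma g_tilde_trunc_nonneg: "g_tilde_trunc M Z l $ n \<ge> 0"
proof -
  have "prob {\<omega> \<in> space M. weight {1..l} \<omega> = n} \<ge> 0" by simp
  moreover have "(\<Prod>j=1..l. a_prob M Z j 0) > 0" by (rule prod_a_prob_0_pos) auto
  ultimately show ?thesis unfolding prob_weight_initial by (simp add: zero_le_mult_iff)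
qed

text \<open>Sum and expectation are interchanged after partitioning by the weight. This evaluates
  integrals against a density that depends on the weight alone.\<close>

lemma integral_weight_series:
  fixes \<phi> :: "(nat \<Rightarrow> nat) \<Rightarrow> real"
  assumes \<phi>: "\<And>x. \<bar>\<phi> x\<bar> \<le> B" and p: "\<And>m. p m \<ge> 0"
    and summ: "summable (\<lambda>m. prob {\<omega> \<in> space M. weight {1..l} \<omega> = m} * p m)"
  shows "integrable M (\<lambda>\<omega>. \<phi> (Zvec {1..l} \<omega>) * p (weight {1..l} \<omega>))"
    and "(\<lambda>m. expectation (\<lambda>\<omega>. \<phi> (Zvec {1..l} \<omega>) * of_bool (weight {1..l} \<omega> = m)) * p m) sums
      expectation (\<lambda>\<omega>. \<phi> (Zvec {1..l} \<omega>) * p (weight {1..l} \<omega>))"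
proof -
  define \<psi> where "\<psi> m x = \<phi> x * of_bool ((\<Sum>j\<in>{1..l}. j * x j) = m)" for m x
  have \<psi>: "\<psi> m (Zvec {1..l} \<omega>) = \<phi> (Zvec {1..l} \<omega>) * of_bool (weight {1..l} \<omega> = m)" for m \<omega>
    using weight_Zvec[OF order_refl[of "{1..l}"], of \<omega>] by (simp add: \<psi>_def)
  have \<psi>_bd: "\<bar>\<psi> m x\<bar> \<le> B" for m x
    using \<phi>[of x] by (auto simp: \<psi>_def)
  define f where "f m \<omega> = \<psi> m (Zvec {1..l} \<omega>) * p m" for m \<omega>
  have int_\<psi>: "integrable M (\<lambda>\<omega>. \<psi> m (Zvec {1..l} \<omega>))" for m
    by (rule integrable_fun_Zvec[of _ "\<psi> m" B, OF _ _ \<psi>_bd]) auto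
  then have int: "integrable M (f m)" for m
    unfolding f_def by (rule integrable_mult_left)
  \<comment> \<open>For fixed \<open>\<omega>\<close> only the term at the actual weight survives,
    so pointwise convergence is trivial.\<close>
  have f_eq: "f m \<omega> = (if m = weight {1..l} \<omega> then \<phi> (Zvec {1..l} \<omega>) * p m else 0)" for m \<omega>
    unfolding f_def \<psi> by simp
  have fin: "(\<lambda>m. f m \<omega>) sums (\<phi> (Zvec {1..l} \<omega>) * p (weight {1..l} \<omega>))" for \<omega>
    unfolding f_eq by (rule sums_single)
  have ae: "AE \<omega> in M. summable (\<lambda>m. norm (f m \<omega>))"
  proof (rule AE_I2)
    fix \<omega>
    show "summable (\<lambda>m. norm (f m \<omega>))"
      by (rule summable_finite[of "{weight {1..l} \<omega>}"]) (auto simp: f_eq)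
  qed
  have "summable (\<lambda>m. expectation (\<lambda>\<omega>. norm (f m \<omega>)))"
  proof (rule summable_comparison_test'[OF summable_mult[OF summ, of B]])
    fix m
    have int1: "integrable M (\<lambda>\<omega>. of_bool (weight {1..l} \<omega> = m) :: real)"
    proof -
      have "integrable M (\<lambda>\<omega>. (\<lambda>x. of_bool ((\<Sum>j\<in>{1..l}. j * x j) = m)) (Zvec {1..l} \<omega>) :: real)"
        by (rule integrable_fun_Zvec[where B = 1]) auto
      then show ?thesis by (simp only: weight_Zvec[OF order_refl[of "{1..l}"], symmetric])
    qed
    have "norm (expectation (\<lambda>\<omega>. norm (f m \<omega>))) = expectation (\<lambda>\<omega>. norm (f m \<omega>))"
      by (simp add: integral_nonneg_AE)
    also have "\<dots> \<le> expectation (\<lambda>\<omega>. B * p m * of_bool (weight {1..l} \<omega> = m))"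
    proof (intro integral_mono integrable_norm int integrable_mult_right int1)
      fix \<omega>
      have "\<bar>\<phi> (Zvec {1..l} \<omega>)\<bar> * p m \<le> B * p m"
        using p[of m] \<phi> by (intro mult_right_mono) auto
      then show "norm (f m \<omega>) \<le> B * p m * of_bool (weight {1..l} \<omega> = m)"
        using p[of m] by (auto simp: f_eq abs_mult)
    qed
    also have "\<dots> = B * (prob {\<omega> \<in> space M. weight {1..l} \<omega> = m} * p m)"
      by (simp add: expectation_of_bool)
    finally show "norm (expectation (\<lambda>\<omega>. norm (f m \<omega>)))
      \<le> B * (prob {\<omega> \<in> space M. weight {1..l} \<omega> = m} * p m)" .
  qed
  note * = integrable_suminf[OF int ae this] sums_integral[OF int ae this]
  have lim: "(\<lambda>\<omega>. \<Sum>m. f m \<omega>) = (\<lambda>\<omega>. \<phi> (Zvec {1..l} \<omega>) * p (weight {1..l} \<omega>))"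
    using fin by (intro ext sums_unique[symmetric])
  show "integrable M (\<lambda>\<omega>. \<phi> (Zvec {1..l} \<omega>) * p (weight {1..l} \<omega>))"
    using *(1) unfolding lim .
  have "expectation (f m) = expectation (\<lambda>\<omega>. \<phi> (Zvec {1..l} \<omega>) * of_bool (weight {1..l} \<omega> = m)) * p m" for m
    unfolding f_def \<psi> by (rule integral_mult_left_zero)
  with *(2) show "(\<lambda>m. expectation (\<lambda>\<omega>. \<phi> (Zvec {1..l} \<omega>) * of_bool (weight {1..l} \<omega> = m)) * p m) sums
      expectation (\<lambda>\<omega>. \<phi> (Zvec {1..l} \<omega>) * p (weight {1..l} \<omega>))"
    unfolding lim by simp
qed

end

section \<open>Limits of the conditional masses\<close>

locale RT_counts = independent_counts +
  fixes \<rho> :: real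
  assumes c_pos: "\<And>n. n \<ge> 1 \<Longrightarrow> c_prob M Z n > 0"
    and \<rho>_nonneg: "\<rho> \<ge> 0"
    and RT: "fps_nth (g_tilde M Z) \<in> RT (ereal \<rho>)"
    and radius: "\<And>l. l \<ge> 1 \<Longrightarrow> fps_conv_radius (inverse (g_tilde_trunc M Z l)) > ereal \<rho>"
begin

text \<open>Membership in \<open>RT\<close> gives only eventual non-vanishing; positivity at every
  index comes from \<open>c_pos\<close>, and from the constant term \<open>1\<close> at index
  \<open>0\<close>.\<close>

lemma g_tilde_pos: "g_tilde M Z $ n > 0"
proof (cases "n = 0")
  case True
  then show ?thesis using g_tilde_trunc_nth_0[OF a0, of 0] g_tilde_trunc_nth[of 0 0] by simp
next
  case False
  then have "c_prob M Z n > 0" by (intro c_pos) simp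
  moreover have "(\<Prod>j=1..n. a_prob M Z j 0) > 0" by (rule prod_a_prob_0_pos) auto
  ultimately show ?thesis unfolding c_prob_eq by (simp add: zero_less_mult_iff)
qed

lemma g_tilde_ratio: "(\<lambda>n. g_tilde M Z $ n / g_tilde M Z $ Suc n) \<longlonglongrightarrow> \<rho>"
  using RT by (simp add: RT_def)

text \<open>The factor by which conditioning on total size \<open>n\<close> reweights the event
  \<open>weight {1..l} \<omega> = m\<close>; it has this meaning for \<open>l \<le> n\<close> and
  \<open>m \<le> n\<close>.\<close>

definition tail_ratio :: "nat \<Rightarrow> nat \<Rightarrow> nat \<Rightarrow> real" where
  "tail_ratio l n m = prob {\<omega> \<in> space M. weight {l<..n} \<omega> = n - m} / c_prob M Z n"

text \<open>The quantity \<open>f(\<rho>) \<rho>^m / A\<close> of the overview.\<close>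

definition tail_limit :: "nat \<Rightarrow> nat \<Rightarrow> real" where
  "tail_limit l m = eval_fps (inverse (g_tilde_trunc M Z l)) \<rho> * \<rho> ^ m / (\<Prod>j=1..l. a_prob M Z j 0)"

lemma tail_ratio_nonneg: "tail_ratio l n m \<ge> 0"
  by (simp add: tail_ratio_def c_prob_def)

text \<open>The ratio factors into a Schur quotient at \<open>n - m\<close>, the coefficient ratio
  tending to \<open>\<rho> ^ m\<close>, and the constant left when the zero-probabilities of the
  tail cancel.\<close>

lemma tail_ratio_tendsto:
  assumes "l \<ge> 1"
  shows "(\<lambda>n. tail_ratio l n m) \<longlonglongrightarrow> tail_limit l m"
proof -
  let ?g = "g_tilde M Z" and ?f = "inverse (g_tilde_trunc M Z l)"
  let ?A = "\<lambda>J. \<Prod>j\<in>J. a_prob M Z j 0"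
  have "(\<lambda>n. (?f * ?g) $ n / ?g $ n) \<longlonglongrightarrow> eval_fps ?f \<rho>"
    by (rule Schur_fps_mult_nth_ratio_tendsto[OF g_tilde_pos g_tilde_ratio \<rho>_nonneg radius[OF assms]])
  then have "(\<lambda>n. (?f * ?g) $ (n - m) / ?g $ (n - m)) \<longlonglongrightarrow> eval_fps ?f \<rho>"
    using LIMSEQ_offset[of "\<lambda>n. (?f * ?g) $ (n - m) / ?g $ (n - m)" m] by simp
  then have "(\<lambda>n. (?f * ?g) $ (n - m) / ?g $ (n - m) * (?g $ (n - m) / ?g $ n) / ?A {1..l}) \<longlonglongrightarrow> tail_limit l m"
    unfolding tail_limit_def
    by (intro tendsto_divide tendsto_mult tendsto_const tendsto_ratio_power[OF g_tilde_pos g_tilde_ratio])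
      (use a0 in \<open>auto simp: less_imp_neq[symmetric]\<close>)
  moreover have "\<forall>\<^sub>F n in sequentially.
      (?f * ?g) $ (n - m) / ?g $ (n - m) * (?g $ (n - m) / ?g $ n) / ?A {1..l} = tail_ratio l n m"
    using eventually_ge_at_top[of l]
  proof eventually_elim
    case (elim n)
    have "{1..n} = {1..l} \<union> {l<..n}" using elim by auto
    then have "?A {1..n} = ?A {1..l} * ?A {l<..n}"
      by (simp only:) (rule prod.union_disjoint, auto)
    moreover have "?A {1..l} > 0" "?A {l<..n} > 0" by (intro prod_a_prob_0_pos; auto)+
    ultimately show ?case
      using prob_weight_tail[OF elim, of "n - m"] g_tilde_pos[of "n - m"] g_tilde_pos[of n]
      by (simp add: tail_ratio_def c_prob_eq del: prod_zero_iff)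
  qed
  ultimately show ?thesis by (rule Lim_transform_eventually)
qed

lemma integral_initial_law_sum:
  fixes f :: "(nat \<Rightarrow> real) \<Rightarrow> real"
  assumes "1 \<le> l" "l \<le> n" and f: "f \<in> borel_measurable (\<Pi>\<^sub>M j\<in>{1..l}. borel)"
    \<comment> \<open>The bound concerns extensional vectors only, since a test function is
      unconstrained off the space of its domain.\<close>
    and bd: "\<And>x. \<bar>f (\<lambda>j\<in>{1..l}. x j)\<bar> \<le> B"
  shows "integral\<^sup>L (initial_law M Z l n) f
    = (\<Sum>m\<le>n. expectation (\<lambda>\<omega>. f (\<lambda>j\<in>{1..l}. real (Z j \<omega>)) * of_bool (weight {1..l} \<omega> = m)) * tail_ratio l n m)"
proof -
  define u where "u x = f (\<lambda>j\<in>{1..l}. real (x j))" for x :: "nat \<Rightarrow> nat"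
  have u: "u (Zvec {1..l} \<omega>) = f (\<lambda>j\<in>{1..l}. real (Z j \<omega>))" for \<omega>
    unfolding u_def by (intro arg_cong[of _ _ f] restrict_ext) simp
  have un: "{1..l} \<union> {l<..n} = {1..n}" using assms by auto
  have c: "c_prob M Z n > 0" using c_pos assms by simp
  have "expectation (\<lambda>\<omega>. u (Zvec {1..l} \<omega>) * of_bool (weight ({1..l} \<union> {l<..n}) \<omega> = n))
      = (\<Sum>m\<le>n. expectation (\<lambda>\<omega>. u (Zvec {1..l} \<omega>) * of_bool (weight {1..l} \<omega> = m))
                  * prob {\<omega> \<in> space M. weight {l<..n} \<omega> = n - m})"
    by (rule expectation_weight_split[where U = B]) (auto simp: u_def bd simp del: One_nat_def)
  then show ?thesis
    unfolding integral_initial_law[OF c \<open>l \<le> n\<close> f] un u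
    by (simp add: sum_divide_distrib tail_ratio_def)
qed

lemma tail_ratio_total:
  assumes "1 \<le> l" "l \<le> n"
  shows "(\<Sum>m\<le>n. prob {\<omega> \<in> space M. weight {1..l} \<omega> = m} * tail_ratio l n m) = 1"
proof -
  have c: "c_prob M Z n > 0" using c_pos assms by simp
  have "(\<Sum>m\<le>n. prob {\<omega> \<in> space M. weight {1..l} \<omega> = m} * tail_ratio l n m)
      = integral\<^sup>L (initial_law M Z l n) (\<lambda>_. 1)"
    using integral_initial_law_sum[OF assms, of "\<lambda>_. 1" 1] by (simp add: expectation_of_bool)
  also have "\<dots> = prob {\<omega> \<in> space M. weight {1..n} \<omega> = n} / c_prob M Z n"
    using integral_initial_law[OF c assms(2), of "\<lambda>_. 1"] by (simp add: expectation_of_bool)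
  also have "\<dots> = 1" using c by (simp add: c_prob_def size_event_def weight_def)
  finally show ?thesis .
qed

text \<open>Every finite sum of limiting masses is a limit of partial sums of probabilities, hence
  at most \<open>1\<close>. Positivity of the inverse's value turns this into a bound on the partial
  sums of \<open>g_tilde_trunc M Z l\<close> at \<rho>, and
  \<open>powser_at_boundary_inverse\<close> then gives total mass exactly \<open>1\<close>.\<close>

lemma tail_limit_total:
  assumes "l \<ge> 1" and pos: "eval_fps (inverse (g_tilde_trunc M Z l)) \<rho> > 0"
  shows "(\<lambda>m. prob {\<omega> \<in> space M. weight {1..l} \<omega> = m} * tail_limit l m) sums 1"
proof -
  let ?f = "eval_fps (inverse (g_tilde_trunc M Z l)) \<rho>"
  define A where "A = (\<Prod>j=1..l. a_prob M Z j 0)"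
  have A: "A > 0" unfolding A_def by (rule prod_a_prob_0_pos) auto
  have eq: "prob {\<omega> \<in> space M. weight {1..l} \<omega> = m} * tail_limit l m = g_tilde_trunc M Z l $ m * \<rho> ^ m * ?f" for m
    using A unfolding prob_weight_initial tail_limit_def A_def[symmetric] by simp
  have "(\<Sum>m<k. g_tilde_trunc M Z l $ m * \<rho> ^ m) \<le> 1 / ?f" for k
  proof -
    have "(\<Sum>m<k. prob {\<omega> \<in> space M. weight {1..l} \<omega> = m} * tail_limit l m) \<le> 1"
    proof (rule LIMSEQ_le_const2)
      show "(\<lambda>n. \<Sum>m<k. prob {\<omega> \<in> space M. weight {1..l} \<omega> = m} * tail_ratio l n m)
        \<longlonglongrightarrow> (\<Sum>m<k. prob {\<omega> \<in> space M. weight {1..l} \<omega> = m} * tail_limit l m)"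
        by (intro tendsto_sum tendsto_mult tendsto_const tail_ratio_tendsto assms)
      have "(\<Sum>m<k. prob {\<omega> \<in> space M. weight {1..l} \<omega> = m} * tail_ratio l n m) \<le> 1"
        if "n \<ge> max k l" for n
      proof -
        have "(\<Sum>m<k. prob {\<omega> \<in> space M. weight {1..l} \<omega> = m} * tail_ratio l n m)
          \<le> (\<Sum>m\<le>n. prob {\<omega> \<in> space M. weight {1..l} \<omega> = m} * tail_ratio l n m)"
          using that by (intro sum_mono2) (auto intro!: mult_nonneg_nonneg tail_ratio_nonneg)
        then show ?thesis using tail_ratio_total[of l n] assms that by simp
      qed
      then show "\<exists>N. \<forall>n\<ge>N. (\<Sum>m<k. prob {\<omega> \<in> space M. weight {1..l} \<omega> = m} * tail_ratio l n m) \<le> 1"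
        by blast
    qed
    then have "(\<Sum>m<k. g_tilde_trunc M Z l $ m * \<rho> ^ m) * ?f \<le> 1"
      unfolding eq sum_distrib_right .
    then show ?thesis using pos by (simp add: field_simps)
  qed
  then have "(\<lambda>m. g_tilde_trunc M Z l $ m * \<rho> ^ m * ?f) sums 1"
    by (rule powser_at_boundary_inverse[rotated 4])
      (use g_tilde_trunc_nth_0[OF a0, of l] g_tilde_trunc_nonneg \<rho>_nonneg radius assms in auto)
  then show ?thesis unfolding eq .
qed

section \<open>Existence and failure of the weak limit\<close>

text \<open>The limit is the law of the first \<open>l\<close> counts under \<open>M\<close> tilted
  by the density \<open>tail_limit\<close> of their weight. Integrals of a test function are sums
  over the weight on both sides, so \<open>sum_tendsto_Scheffe\<close> applies.\<close>

lemma weak_limit_exists: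
  assumes l: "l \<ge> 1" and pos: "eval_fps (inverse (g_tilde_trunc M Z l)) \<rho> > 0"
  shows "\<exists>\<mu>. prob_space \<mu> \<and> sets \<mu> = sets (\<Pi>\<^sub>M j\<in>{1..l}. (borel :: real measure))
           \<and> weak_conv_on_Rn l (initial_law M Z l) \<mu>"
proof -
  let ?W = "weight {1..l}" and ?R = "\<lambda>\<omega>. \<lambda>j\<in>{1..l}. real (Z j \<omega>)"
  define t where "t m = prob {\<omega> \<in> space M. ?W \<omega> = m}" for m
  define D where "D \<omega> = tail_limit l (?W \<omega>)" for \<omega>
  define \<mu> where "\<mu> = distr (density M (\<lambda>\<omega>. ennreal (D \<omega>))) (\<Pi>\<^sub>M j\<in>{1..l}. borel) ?R"
  have p0: "tail_limit l m \<ge> 0" for m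
    unfolding tail_limit_def using pos \<rho>_nonneg
    by (intro divide_nonneg_nonneg mult_nonneg_nonneg prod_nonneg) (auto simp: a_prob_def)
  have tot: "(\<lambda>m. t m * tail_limit l m) sums 1"
    unfolding t_def by (rule tail_limit_total[OF assms])
  note summ = sums_summable[OF tot, unfolded t_def]
  have D0: "D \<omega> \<ge> 0" for \<omega> by (simp add: D_def p0)
  have D_meas: "D \<in> borel_measurable M"
    unfolding D_def by (rule measurable_compose[OF measurable_weight]) auto
  have R: "?R \<in> M \<rightarrow>\<^sub>M (\<Pi>\<^sub>M j\<in>{1..l}. borel)"
  proof (intro measurable_restrict)
    fix j assume "j \<in> {1..l}"
    then show "(\<lambda>\<omega>. real (Z j \<omega>)) \<in> borel_measurable M"
      by (intro measurable_compose[OF measurable_Z]) auto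
  qed
  \<comment> \<open>Taking the constant function \<open>1\<close> identifies the total mass of
    \<open>D\<close> with the sum of the limiting masses.\<close>
  have "(\<lambda>m. t m * tail_limit l m) sums expectation D" "integrable M D"
    using integral_weight_series[of "\<lambda>_. 1" 1 "tail_limit l" l, OF _ p0 summ]
    by (simp_all add: expectation_of_bool t_def D_def[abs_def])
  then have D_int: "integrable M D" "expectation D = 1"
    using sums_unique2[OF _ tot] by auto
  have "prob_space (density M (\<lambda>\<omega>. ennreal (D \<omega>)))"
  proof (rule prob_spaceI)
    have "emeasure (density M (\<lambda>\<omega>. ennreal (D \<omega>))) (space M) = (\<integral>\<^sup>+\<omega>. ennreal (D \<omega>) \<partial>M)"
      using D_meas by (subst emeasure_density) (auto intro!: nn_integral_cong)
    also have "\<dots> = ennreal (expectation D)"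
      by (rule nn_integral_eq_integral[OF D_int(1)]) (simp add: D0)
    finally show "emeasure (density M (\<lambda>\<omega>. ennreal (D \<omega>))) (space (density M (\<lambda>\<omega>. ennreal (D \<omega>)))) = 1"
      using D_int(2) by simp
  qed
  then have "prob_space \<mu>"
    unfolding \<mu>_def by (rule prob_space.prob_space_distr) (use R in simp)
  moreover have "weak_conv_on_Rn l (initial_law M Z l) \<mu>"
    unfolding weak_conv_on_Rn_def
  proof (intro allI impI, elim conjE)
    fix f :: "(nat \<Rightarrow> real) \<Rightarrow> real"
    assume cont: "continuous_map (powertop_real {1..l}) euclideanreal f"
      and "bounded (f ` topspace (powertop_real {1..l}))"
    then obtain B where "\<And>x. x \<in> topspace (powertop_real {1..l}) \<Longrightarrow> \<bar>f x\<bar> \<le> B"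
      unfolding bounded_iff by auto
    then have B: "\<bar>f (\<lambda>j\<in>{1..l}. x j)\<bar> \<le> B" for x by auto
    have f: "f \<in> borel_measurable (\<Pi>\<^sub>M j\<in>{1..l}. borel)"
      by (rule borel_measurable_continuous_map_powertop[OF cont])
    define F where "F m = expectation (\<lambda>\<omega>. f (?R \<omega>) * of_bool (?W \<omega> = m))" for m
    define \<phi> where "\<phi> x = f (\<lambda>j\<in>{1..l}. real (x j))" for x :: "nat \<Rightarrow> nat"
    have \<phi>: "\<phi> (Zvec {1..l} \<omega>) = f (?R \<omega>)" for \<omega>
      unfolding \<phi>_def by (intro arg_cong[of _ _ f] restrict_ext) simp
    have "(\<lambda>m. F m * tail_limit l m) sums expectation (\<lambda>\<omega>. f (?R \<omega>) * D \<omega>)"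
      using integral_weight_series(2)[of \<phi> B "tail_limit l" l, OF _ p0 summ] B
      unfolding \<phi> D_def F_def by (simp add: \<phi>_def)
    moreover have "integral\<^sup>L \<mu> f = expectation (\<lambda>\<omega>. f (?R \<omega>) * D \<omega>)"
    proof -
      have "integral\<^sup>L \<mu> f = integral\<^sup>L (density M (\<lambda>\<omega>. ennreal (D \<omega>))) (\<lambda>\<omega>. f (?R \<omega>))"
        unfolding \<mu>_def by (rule integral_distr[OF _ f]) (use R in simp)
      also have "\<dots> = expectation (\<lambda>\<omega>. D \<omega> * f (?R \<omega>))"
        using D_meas D0 by (intro integral_real_density measurable_compose[OF R f]) auto
      finally show ?thesis by (simp only: mult.commute)
    qed
    ultimately have S: "(\<lambda>m. F m * tail_limit l m) sums integral\<^sup>L \<mu> f" by simp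
    have "(\<lambda>n. \<Sum>m\<le>n. F m * tail_ratio l n m) \<longlonglongrightarrow> integral\<^sup>L \<mu> f"
    proof (rule sum_tendsto_Scheffe[OF tail_ratio_tendsto[OF l] tail_ratio_nonneg _ tot _ S])
      show "\<forall>\<^sub>F n in sequentially. (\<Sum>m\<le>n. t m * tail_ratio l n m) = 1"
        using eventually_ge_at_top[of l]
        by eventually_elim (unfold t_def, rule tail_ratio_total[OF l])
      show "\<bar>F m\<bar> \<le> B * t m" for m
      proof -
        have meas: "(\<lambda>\<omega>. of_bool (?W \<omega> = m) :: real) \<in> borel_measurable M"
          by (rule measurable_compose[OF measurable_weight]) auto
        have "\<bar>F m\<bar> \<le> expectation (\<lambda>\<omega>. B * of_bool (?W \<omega> = m))"
          unfolding F_def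
        proof (rule integral_abs_bound[THEN order_trans], rule integral_mono')
          show "integrable M (\<lambda>\<omega>. B * of_bool (?W \<omega> = m))"
            using meas by (intro integrable_mult_right integrable_const_bound[of _ 1]) auto
          show "\<bar>f (?R \<omega>) * of_bool (?W \<omega> = m)\<bar> \<le> B * of_bool (?W \<omega> = m)" for \<omega>
            using B[of "\<lambda>j. real (Z j \<omega>)"] by (simp add: abs_mult)
          show "0 \<le> B * of_bool (?W \<omega> = m)" for \<omega>
            using B[of "\<lambda>j. real (Z j \<omega>)"] by simp
        qed
        then show ?thesis by (simp add: expectation_of_bool t_def)
      qed
    qed
    then show "(\<lambda>n. integral\<^sup>L (initial_law M Z l n) f) \<longlonglongrightarrow> integral\<^sup>L \<mu> f"
    proof (rule Lim_transform_eventually)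
      show "\<forall>\<^sub>F n in sequentially. (\<Sum>m\<le>n. F m * tail_ratio l n m) = integral\<^sup>L (initial_law M Z l n) f"
        using eventually_ge_at_top[of l]
        by eventually_elim (unfold F_def, rule integral_initial_law_sum[OF l _ f B, symmetric])
    qed
  qed
  ultimately show ?thesis by (intro exI[of _ \<mu>]) (simp add: \<mu>_def)
qed

text \<open>The mass of the first count escapes to infinity: each cutoff sees finitely many weights,
  all with limiting factor \<open>0\<close>, so its integral against a weak limit would
  vanish.\<close>

lemma no_weak_limit:
  assumes zero: "eval_fps (inverse (g_tilde_trunc M Z 1)) \<rho> = 0"
    and "prob_space \<mu>" and sets: "sets \<mu> = sets (\<Pi>\<^sub>M j\<in>{1..1}. (borel :: real measure))"
  shows "\<not> weak_conv_on_Rn 1 (initial_law M Z 1) \<mu>"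
proof
  assume conv: "weak_conv_on_Rn 1 (initial_law M Z 1) \<mu>"
  interpret \<mu>: prob_space \<mu> by fact
  \<comment> \<open>A continuous cutoff: \<open>1\<close> for \<open>x 1 \<le> real K - 1\<close>,
    \<open>0\<close> for \<open>x 1 \<ge> real K\<close>, linear in between.\<close>
  define f where "f K x = max 0 (min 1 (real K - x 1))" for K :: nat and x :: "nat \<Rightarrow> real"
  have cont: "continuous_map (powertop_real {1..1}) euclideanreal (f K)" for K
    unfolding f_def
    by (intro continuous_map_real_max continuous_map_real_min continuous_map_diff
        continuous_map_const[THEN iffD2] continuous_map_product_projection) auto
  have bd: "\<bar>f K x\<bar> \<le> 1" for K x by (simp add: f_def)
  have f: "f K \<in> borel_measurable (\<Pi>\<^sub>M j\<in>{1..1}. borel)" for K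
    by (rule borel_measurable_continuous_map_powertop[OF cont])
  have int0: "integral\<^sup>L \<mu> (f K) = 0" for K
  proof -
    define F where
      "F m = expectation (\<lambda>\<omega>. f K (\<lambda>j\<in>{1..1}. real (Z j \<omega>)) * of_bool (weight {1..1} \<omega> = m))" for m
    \<comment> \<open>\<open>weight {1..1}\<close> is the first count itself, so
      \<open>m \<ge> K\<close> places it where the cutoff is zero.\<close>
    have F0: "F m = 0" if "m \<ge> K" for m
    proof -
      have "f K (\<lambda>j\<in>{1..1}. real (Z j \<omega>)) * of_bool (weight {1..1} \<omega> = m) = 0" for \<omega>
        using that by (auto simp: f_def weight_def)
      then show ?thesis unfolding F_def by (simp only: Bochner_Integration.integral_zero)
    qed
    have "(\<Sum>m<K. F m * tail_limit 1 m) = 0"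
      using zero by (simp add: tail_limit_def)
    moreover have "(\<lambda>n. \<Sum>m<K. F m * tail_ratio 1 n m) \<longlonglongrightarrow> (\<Sum>m<K. F m * tail_limit 1 m)"
      by (intro tendsto_sum tendsto_mult tendsto_const tail_ratio_tendsto order_refl)
    ultimately have "(\<lambda>n. \<Sum>m<K. F m * tail_ratio 1 n m) \<longlonglongrightarrow> 0"
      by (simp only:)
    moreover have "\<forall>\<^sub>F n in sequentially.
        (\<Sum>m<K. F m * tail_ratio 1 n m) = integral\<^sup>L (initial_law M Z 1 n) (f K)"
      using eventually_ge_at_top[of "max K 1"]
    proof eventually_elim
      case (elim n)
      have "integral\<^sup>L (initial_law M Z 1 n) (f K) = (\<Sum>m\<le>n. F m * tail_ratio 1 n m)"
        unfolding F_def using elim by (intro integral_initial_law_sum[OF _ _ f bd]) auto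
      also have "\<dots> = (\<Sum>m<K. F m * tail_ratio 1 n m)"
        using elim F0 by (intro sum.mono_neutral_right) auto
      finally show ?case ..
    qed
    ultimately have "(\<lambda>n. integral\<^sup>L (initial_law M Z 1 n) (f K)) \<longlonglongrightarrow> 0"
      by (rule Lim_transform_eventually)
    moreover have "bounded (f K ` topspace (powertop_real {1..1}))"
      unfolding bounded_iff using bd by auto
    with conv cont[of K] have "(\<lambda>n. integral\<^sup>L (initial_law M Z 1 n) (f K)) \<longlonglongrightarrow> integral\<^sup>L \<mu> (f K)"
      unfolding weak_conv_on_Rn_def by blast
    ultimately show ?thesis by (rule LIMSEQ_unique[symmetric])
  qed
  \<comment> \<open>Each point eventually lies under the plateau of the cutoff, so dominated
    convergence recovers the total mass \<open>1\<close>, contradicting \<open>int0\<close>.\<close>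
  have "(\<lambda>K. integral\<^sup>L \<mu> (f K)) \<longlonglongrightarrow> integral\<^sup>L \<mu> (\<lambda>_. 1)"
  proof (rule integral_dominated_convergence[where w = "\<lambda>_. 1"])
    show "f K \<in> borel_measurable \<mu>" for K
      using f measurable_cong_sets[OF sets refl] by blast
    show "AE x in \<mu>. (\<lambda>K. f K x) \<longlonglongrightarrow> 1"
    proof (rule AE_I2)
      fix x :: "nat \<Rightarrow> real"
      obtain N where N: "x 1 + 1 \<le> real N" using real_arch_simple by blast
      have "\<forall>\<^sub>F K in sequentially. f K x = 1"
        using eventually_ge_at_top[of N]
      proof eventually_elim
        case (elim K)
        then have "x 1 + 1 \<le> real K" using N by linarith
        then show ?case by (simp add: f_def)
      qed
      then show "(\<lambda>K. f K x) \<longlonglongrightarrow> 1" by (rule tendsto_eventually)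
    qed
  qed (use bd in auto)
  then have "(\<lambda>K. 0 :: real) \<longlonglongrightarrow> 1"
    by (simp add: int0 \<mu>.prob_space)
  then show False by (simp add: LIMSEQ_const_iff)
qed

end

theorem proposition2:
  fixes M :: "'a measure" and Z :: "nat \<Rightarrow> 'a \<Rightarrow> nat" and \<rho> :: real
  assumes "prob_space M"
    and "prob_space.indep_vars M (\<lambda>_. count_space UNIV) Z {1..}"
    and "\<And>n. n \<ge> 1 \<Longrightarrow> c_prob M Z n > 0"
    and "\<And>j. j \<ge> 1 \<Longrightarrow> a_prob M Z j 0 > 0"
    and "\<rho> \<ge> 0"
    and "fps_nth (g_tilde M Z) \<in> RT (ereal \<rho>)"
    and "\<And>l. l \<ge> 1 \<Longrightarrow> fps_conv_radius (inverse (g_tilde_trunc M Z l)) > ereal \<rho>"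
  shows "((\<forall>l\<ge>1. eval_fps (inverse (g_tilde_trunc M Z l)) \<rho> > 0) \<longrightarrow> structure_converges M Z)
       \<and> ((\<forall>l\<ge>1. eval_fps (inverse (g_tilde_trunc M Z l)) \<rho> = 0) \<longrightarrow> structure_diverges M Z)"
proof -
  interpret prob_space M by fact
  interpret RT_counts M Z \<rho>
    by unfold_locales (use assms in auto)
  show ?thesis
    unfolding structure_converges_def using weak_limit_exists no_weak_limit by blast
qed

end
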